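(* Let $v\in(0,1)$ and let $a,b>0$ be real numbers with $a<b$. Then $$v(1-v)\left(1-\frac{a}{b}\right)^2a\le A_v(a,b)-H_v(a,b)\le v(1-v)\left(1-\frac{b}{a}\right)^2b.$$
   Context: For $a,b>0$ and $0\le v\le 1$, the weighted arithmetic and harmonic means are $A_v(a,b)=va+(1-v)b$ and $H_v(a,b)=\left(va^{-1}+(1-v)b^{-1}\right)^{-1}$. *)

theory Defs
  imports Complex_Main
begin

(* Only meaningful for a, b > 0 and 0 \<le> v \<le> 1. The weight v is attached to the first argument. *)

definition weighted_arith_mean :: "real \<Rightarrow> real \<Rightarrow> real \<Rightarrow> real" where
  "weighted_arith_mean v a b = v * a + (1 - v) * b"

definition weighted_harm_mean :: "real \<Rightarrow> real \<Rightarrow> real \<Rightarrow> real" where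
  "weighted_harm_mean v a b = inverse (v * inverse a + (1 - v) * inverse b)"

end

theory Submission
  imports Defs
begin

text \<open>Both means have the common denominator \<open>D = v b + (1 - v) a\<close>, and
  \<open>A - H = v (1 - v) (b - a)\<^sup>2 / D\<close>. As \<open>D\<close> lies between \<open>a\<close> and \<open>b\<close>, we have
  \<open>a / b\<^sup>2 \<le> 1 / b \<le> 1 / D \<le> 1 / a \<le> b / a\<^sup>2\<close>, and multiplying by
  \<open>v (1 - v) (b - a)\<^sup>2\<close> gives both bounds.\<close>

lemma weighted_arith_minus_harm_mean:
  fixes v a b :: real
  assumes "a \<noteq> 0" "b \<noteq> 0" "v * b + (1 - v) * a \<noteq> 0"
  shows "weighted_arith_mean v a b - weighted_harm_mean v a b
    = v * (1 - v) * (b - a)\<^sup>2 * (1 / (v * b + (1 - v) * a))"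
proof -
  let ?D = "v * b + (1 - v) * a"
  have "v * inverse a + (1 - v) * inverse b = ?D / (a * b)"
    using assms(1,2) by (simp add: field_simps)
  then have H: "weighted_harm_mean v a b = a * b / ?D"
    by (simp add: weighted_harm_mean_def)
  \<comment> \<open>The coefficient of \<open>a * b\<close> in the product is v^2 + (1 - v)^2 = 1 -
    2 v (1 - v), so subtracting \<open>a * b\<close> leaves a perfect square.\<close>
  have "(v * a + (1 - v) * b) * ?D - a * b = v * (1 - v) * (b - a)\<^sup>2"
    by algebra
  then show ?thesis
    using assms(3) by (simp add: H weighted_arith_mean_def diff_divide_eq_iff)
qed

theorem theorem2p4:
  fixes v a b :: real
  assumes "0 < v" and "v < 1"
    and "0 < a" and "0 < b" and "a < b"
  shows "v * (1 - v) * (1 - a / b)\<^sup>2 * a \<le> weighted_arith_mean v a b - weighted_harm_mean v a b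
    \<and> weighted_arith_mean v a b - weighted_harm_mean v a b \<le> v * (1 - v) * (1 - b / a)\<^sup>2 * b"
proof -
  let ?D = "v * b + (1 - v) * a" and ?c = "v * (1 - v) * (b - a)\<^sup>2"
  have c: "0 \<le> ?c"
    using assms by simp
  \<comment> \<open>Add \<open>(1 - v) * a\<close> to \<open>v * a \<le> v * b\<close>.\<close>
  have aD: "a \<le> ?D"
    using mult_left_mono[of a b v] assms by (simp add: algebra_simps)
  have Db: "?D \<le> b"
    using mult_left_mono[of a b "1 - v"] assms by (simp add: algebra_simps)
  have D: "0 < ?D"
    using aD assms by linarith
  have "a / b\<^sup>2 \<le> 1 / b"
    using assms by (simp add: field_simps power2_eq_square)
  also have "\<dots> \<le> 1 / ?D"
    using Db D by (intro divide_left_mono) (auto intro: mult_pos_pos assms)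
  finally have lower: "?c * (a / b\<^sup>2) \<le> ?c * (1 / ?D)"
    using c by (rule mult_left_mono)
  have "1 / ?D \<le> 1 / a"
    using aD D by (intro divide_left_mono) (auto intro: mult_pos_pos assms)
  also have "\<dots> \<le> b / a\<^sup>2"
    using assms by (simp add: field_simps power2_eq_square)
  finally have upper: "?c * (1 / ?D) \<le> ?c * (b / a\<^sup>2)"
    using c by (rule mult_left_mono)
  have "1 - a / b = (b - a) / b" "1 - b / a = (a - b) / a"
    using assms by (simp_all add: diff_divide_distrib)
  \<comment> \<open>The numerators b - a and a - b differ only in sign;
    \<open>power2_commute\<close> identifies their squares, so both bounds share the factor
    \<open>?c\<close>.\<close>
  then have "v * (1 - v) * (1 - a / b)\<^sup>2 * a = ?c * (a / b\<^sup>2)"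
    and "v * (1 - v) * (1 - b / a)\<^sup>2 * b = ?c * (b / a\<^sup>2)"
    by (simp_all add: power_divide power2_commute)
  with lower upper show ?thesis
    using weighted_arith_minus_harm_mean[of a b v] assms D by simp
qed

end
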